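(* Let $R$ be a finite noncommutative ring such that $|R|\notin\{8,12,16,24,28\}$, and let $r\in R$. Then $\Delta_R^r$ has a vertex of degree $6$ if and only if $r=0$ and $R$ is isomorphic to $E(9)$ or $F(9)$.
   Context: Rings are associative and not assumed to have a unity. $[x,y]:=xy-yx$. $Z(R)$ is the center of $R$. $\Delta_R^r$ is the simple undirected graph with vertex set $R\setminus Z(R)$ in which two distinct vertices $x,y$ are adjacent if and only if $[x,y]\neq r$ and $[x,y]\neq -r$. For a prime $p$, $E(p^2)=\langle a,b: pa=pb=0,\ a^2=a,\ b^2=b,\ ab=a,\ ba=b\rangle$ and $F(p^2)=\langle x,y: px=py=0,\ x^2=x,\ y^2=y,\ xy=y,\ yx=x\rangle$; these are (non-unital) rings of order $p^2$ whose additive group is free over $\mathbb{Z}/p$ on the two generators, with multiplication determined bilinearly by the given relations. *)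

theory Defs
  imports Main "HOL-Library.Numeral_Type"
begin

text \<open>
  Rings are types of class \<^class>\<open>ring\<close>: associative, not assumed to have a unity.
\<close>

definition commutator :: "'a::ring \<Rightarrow> 'a \<Rightarrow> 'a" where
  "commutator x y = x * y - y * x"

definition ring_center :: "'a::ring set" where
  "ring_center = {z. \<forall>x. z * x = x * z}"

definition is_ring_iso :: "('a::ring \<Rightarrow> 'b::ring) \<Rightarrow> bool" where
  "is_ring_iso f \<longleftrightarrow> bij f \<and> (\<forall>x y. f (x + y) = f x + f y) \<and> (\<forall>x y. f (x * y) = f x * f y)"

definition Delta_verts :: "'a::ring set" where
  "Delta_verts = - ring_center"

definition Delta_adj :: "'a::ring \<Rightarrow> 'a \<Rightarrow> 'a \<Rightarrow> bool" where
  "Delta_adj r x y \<longleftrightarrow>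
     x \<in> Delta_verts \<and> y \<in> Delta_verts \<and> x \<noteq> y \<and> commutator x y \<noteq> r \<and> commutator x y \<noteq> - r"

definition Delta_degree :: "'a::ring \<Rightarrow> 'a \<Rightarrow> nat" where
  "Delta_degree r x = card {y. Delta_adj r x y}"

lemma Delta_adj_sym: "Delta_adj r x y \<longleftrightarrow> Delta_adj r y x"
proof -
  have "commutator y x = - commutator x y"
    by (simp add: commutator_def)
  then show ?thesis
    by (auto simp: Delta_adj_def)
qed

text \<open>
  The rings \<open>E(p\<^sup>2)\<close> and \<open>F(p\<^sup>2)\<close> are the cases \<open>'k = \<int>/p\<close> of the following two
  constructions; the numeral type \<open>3\<close> of \<^theory>\<open>HOL-Library.Numeral_Type\<close> is \<open>\<int>/3\<close>, so
  \<open>E(9)\<close> is \<open>3 E_ring\<close> and \<open>F(9)\<close> is \<open>3 F_ring\<close>. The element \<open>E_elem s t\<close> stands for \<open>s a + t b\<close>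
  and \<open>F_elem s t\<close> for \<open>s x + t y\<close>. The products are the bilinear extensions of
  \<open>a\<^sup>2 = a, b\<^sup>2 = b, ab = a, ba = b\<close> and of \<open>x\<^sup>2 = x, y\<^sup>2 = y, xy = y, yx = x\<close>.
\<close>

datatype 'k E_ring = E_elem 'k 'k

instantiation E_ring :: (comm_ring) ring
begin

definition zero_E_ring :: "'a E_ring" where
  "0 = E_elem 0 0"

fun plus_E_ring :: "'a E_ring \<Rightarrow> 'a E_ring \<Rightarrow> 'a E_ring" where
  "E_elem s t + E_elem u v = E_elem (s + u) (t + v)"

fun uminus_E_ring :: "'a E_ring \<Rightarrow> 'a E_ring" where
  "- E_elem s t = E_elem (- s) (- t)"

fun minus_E_ring :: "'a E_ring \<Rightarrow> 'a E_ring \<Rightarrow> 'a E_ring" where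
  "E_elem s t - E_elem u v = E_elem (s - u) (t - v)"

fun times_E_ring :: "'a E_ring \<Rightarrow> 'a E_ring \<Rightarrow> 'a E_ring" where
  "E_elem s t * E_elem u v = E_elem (s * u + s * v) (t * u + t * v)"

instance
proof
  fix x y z :: "'a E_ring"
  show "x + y + z = x + (y + z)" by (cases x; cases y; cases z) (simp add: algebra_simps)
  show "x + y = y + x" by (cases x; cases y) (simp add: algebra_simps)
  show "0 + x = x" by (cases x) (simp add: zero_E_ring_def)
  show "- x + x = 0" by (cases x) (simp add: zero_E_ring_def)
  show "x - y = x + - y" by (cases x; cases y) simp
  show "x * y * z = x * (y * z)" by (cases x; cases y; cases z) (simp add: algebra_simps)
  show "(x + y) * z = x * z + y * z" by (cases x; cases y; cases z) (simp add: algebra_simps)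
  show "x * (y + z) = x * y + x * z" by (cases x; cases y; cases z) (simp add: algebra_simps)
qed

end

datatype 'k F_ring = F_elem 'k 'k

instantiation F_ring :: (comm_ring) ring
begin

definition zero_F_ring :: "'a F_ring" where
  "0 = F_elem 0 0"

fun plus_F_ring :: "'a F_ring \<Rightarrow> 'a F_ring \<Rightarrow> 'a F_ring" where
  "F_elem s t + F_elem u v = F_elem (s + u) (t + v)"

fun uminus_F_ring :: "'a F_ring \<Rightarrow> 'a F_ring" where
  "- F_elem s t = F_elem (- s) (- t)"

fun minus_F_ring :: "'a F_ring \<Rightarrow> 'a F_ring \<Rightarrow> 'a F_ring" where
  "F_elem s t - F_elem u v = F_elem (s - u) (t - v)"

fun times_F_ring :: "'a F_ring \<Rightarrow> 'a F_ring \<Rightarrow> 'a F_ring" where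
  "F_elem s t * F_elem u v = F_elem (s * u + t * u) (s * v + t * v)"

instance
proof
  fix x y z :: "'a F_ring"
  show "x + y + z = x + (y + z)" by (cases x; cases y; cases z) (simp add: algebra_simps)
  show "x + y = y + x" by (cases x; cases y) (simp add: algebra_simps)
  show "0 + x = x" by (cases x) (simp add: zero_F_ring_def)
  show "- x + x = 0" by (cases x) (simp add: zero_F_ring_def)
  show "x - y = x + - y" by (cases x; cases y) simp
  show "x * y * z = x * (y * z)" by (cases x; cases y; cases z) (simp add: algebra_simps)
  show "(x + y) * z = x * z + y * z" by (cases x; cases y; cases z) (simp add: algebra_simps)
  show "x * (y + z) = x * y + x * z" by (cases x; cases y; cases z) (simp add: algebra_simps)
qed

end

lemma E_ring_relations:
  fixes a b :: "'k::comm_ring_1 E_ring"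
  defines "a \<equiv> E_elem 1 0" and "b \<equiv> E_elem 0 1"
  shows "a * a = a" "b * b = b" "a * b = a" "b * a = b"
  by (simp_all add: a_def b_def)

lemma F_ring_relations:
  fixes x y :: "'k::comm_ring_1 F_ring"
  defines "x \<equiv> F_elem 1 0" and "y \<equiv> F_elem 0 1"
  shows "x * x = x" "y * y = y" "x * y = y" "y * x = x"
  by (simp_all add: x_def y_def)

lemma add_add_self_3: "s + s + s = (0 :: 3)"
proof -
  have "s + s + s = 3 * s" by (simp add: algebra_simps)
  also have "(3 :: 3) = 0" by simp
  finally show ?thesis by simp
qed

lemma E9_char: "(z :: 3 E_ring) + z + z = 0"
  by (cases z) (simp only: zero_E_ring_def plus_E_ring.simps add_add_self_3)

lemma F9_char: "(w :: 3 F_ring) + w + w = 0"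
  by (cases w) (simp only: zero_F_ring_def plus_F_ring.simps add_add_self_3)

end

theory Submission
  imports Defs "HOL-Algebra.Multiplicative_Group"
begin

text \<open>
  Write \<open>C(x)\<close> for the centralizer of a vertex \<open>x\<close>; it lies strictly between the center \<open>Z\<close>
  and \<open>R\<close>, so \<open>|C(x)| = m |Z|\<close> and \<open>|R| = k |C(x)|\<close> with \<open>m, k \<ge> 2\<close>. The solutions \<open>y\<close> of
  \<open>[x, y] = r\<close> are empty or form a coset of \<open>C(x)\<close>, so the degree of \<open>x\<close> is \<open>|R| - |C(x)|\<close> for
  \<open>r = 0\<close>, and otherwise it is \<open>|R| - |Z| - j |C(x)| - 1\<close> with \<open>j \<in> {0, 1, 2}\<close>. Moreover \<open>m\<close> and
  \<open>k\<close> are not coprime, because both annihilate every \<open>[x, y]\<close>. Solving for degree \<open>6\<close> outside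
  the excluded orders leaves only \<open>r = 0\<close> and \<open>|R| = 9\<close>. In a noncommutative ring of order \<open>9\<close>
  the centralizer of every nonzero \<open>x\<close> is \<open>{0, x, -x}\<close>. Hence \<open>x\<^sup>2\<close> is \<open>0\<close>, \<open>x\<close> or \<open>-x\<close>. If all
  squares vanished, \<open>[x, y] \<noteq> 0\<close> would be impossible because \<open>x y\<close> would commute with \<open>x\<close> and
  \<open>y\<close>; so there is an idempotent \<open>a \<noteq> 0\<close>, and it is not central. For a nonzero \<open>n\<close> in
  \<open>(1 - a) R a\<close> or \<open>a R (1 - a)\<close> the pair \<open>a, a + n\<close> satisfies the relations of \<open>E(9)\<close> or
  \<open>F(9)\<close>.
\<close>

section \<open>Subgroups of additive groups\<close>

definition add_subgroup :: "'a::ab_group_add set \<Rightarrow> bool" where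
  "add_subgroup S \<longleftrightarrow> 0 \<in> S \<and> (\<forall>x\<in>S. \<forall>y\<in>S. x - y \<in> S)"

text \<open>Makes Lagrange's theorem, quotients and element orders from group theory available for
  the addition of a type class.\<close>

definition additive_group :: "'a::ab_group_add set \<Rightarrow> 'a monoid" where
  "additive_group S = \<lparr>carrier = S, mult = (+), one = 0\<rparr>"

lemma additive_group_simps [simp]:
  "carrier (additive_group S) = S" "mult (additive_group S) = (+)" "one (additive_group S) = 0"
  by (simp_all add: additive_group_def)

lemma add_subgroup_uminus: "add_subgroup S \<Longrightarrow> x \<in> S \<Longrightarrow> - x \<in> S"
  unfolding add_subgroup_def by (metis diff_0)

lemma add_subgroup_plus: "add_subgroup S \<Longrightarrow> x \<in> S \<Longrightarrow> y \<in> S \<Longrightarrow> x + y \<in> S"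
  using add_subgroup_uminus[of S y] unfolding add_subgroup_def by (metis diff_minus_eq_add)

lemma add_subgroup_UNIV: "add_subgroup UNIV"
  by (simp add: add_subgroup_def)

lemma comm_group_additive_group:
  assumes "add_subgroup S"
  shows "comm_group (additive_group S)"
proof (rule comm_groupI)
  fix x assume "x \<in> carrier (additive_group S)"
  then have "- x \<in> carrier (additive_group S)" "- x + x = 0"
    using assms by (simp_all add: add_subgroup_uminus)
  then show "\<exists>y\<in>carrier (additive_group S). y \<otimes>\<^bsub>additive_group S\<^esub> x = \<one>\<^bsub>additive_group S\<^esub>"
    by (metis additive_group_simps(2,3))
qed (use assms add_subgroup_plus[OF assms] in \<open>auto simp: add_subgroup_def algebra_simps\<close>)

lemma subgroup_additive_group:
  assumes "add_subgroup H" "add_subgroup K" "H \<subseteq> K"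
  shows "subgroup H (additive_group K)"
proof -
  interpret comm_group "additive_group K"
    by (rule comm_group_additive_group[OF assms(2)])
  show ?thesis
  proof (rule subgroupI)
    fix x assume "x \<in> H"
    then have "- x \<in> H" "- x + x = 0" "x \<in> K" "- x \<in> K"
      using assms add_subgroup_uminus by auto
    moreover from this have "inv\<^bsub>additive_group K\<^esub> x = - x"
      by (intro inv_equality) auto
    ultimately show "inv\<^bsub>additive_group K\<^esub> x \<in> H" by simp
  qed (use assms in \<open>auto simp: add_subgroup_def intro: add_subgroup_plus\<close>)
qed

text \<open>The constant sum serves as the multiple n x; without a unity, n need not be a ring
  element.\<close>

lemma additive_group_pow: "x [^]\<^bsub>additive_group S\<^esub> (n::nat) = (\<Sum>i<n. x)"
  by (induction n) (simp_all add: nat_pow_def)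

text \<open>The witness is the index of H in K: Lagrange gives the count, and the quotient K/H,
  having order n, is annihilated by n.\<close>

lemma add_subgroup_index:
  fixes K :: "'a::ab_group_add set"
  assumes "add_subgroup H" "add_subgroup K" "H \<subseteq> K" "finite K"
  obtains n where "card K = n * card H" "\<And>x. x \<in> K \<Longrightarrow> (\<Sum>i<n. x) \<in> H"
proof -
  interpret comm_group "additive_group K"
    by (rule comm_group_additive_group[OF assms(2)])
  have sub: "subgroup H (additive_group K)"
    by (rule subgroup_additive_group[OF assms(1-3)])
  then interpret N: normal H "additive_group K"
    by (rule subgroup_imp_normal)
  define n where "n = card (rcosets\<^bsub>additive_group K\<^esub> H)"
  have "card K = n * card H"
    using lagrange[OF sub] by (simp add: n_def order_def)
  moreover have "(\<Sum>i<n. x) \<in> H" if x: "x \<in> K" for x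
  proof -
    let ?Q = "additive_group K Mod H"
    interpret Q: group ?Q by (rule N.factorgroup_is_group)
    have "(H #>\<^bsub>additive_group K\<^esub> x) [^]\<^bsub>?Q\<^esub> Coset.order ?Q = \<one>\<^bsub>?Q\<^esub>"
      using x by (intro Q.pow_order_eq_1) (auto simp: FactGroup_def RCOSETS_def)
    moreover have "Coset.order ?Q = n"
      by (simp add: n_def Coset.order_def FactGroup_def)
    ultimately have "H #>\<^bsub>additive_group K\<^esub> (x [^]\<^bsub>additive_group K\<^esub> n) = H"
      using hom_nat_pow[OF N.r_coset_hom_Mod _ is_group Q.is_group, of x n] x by (simp add: FactGroup_def)
    then have "x [^]\<^bsub>additive_group K\<^esub> n \<in> H"
      using x sub by (metis coset_join1 nat_pow_closed additive_group_simps(1) subgroup.subset)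
    then show ?thesis by (simp add: additive_group_pow)
  qed
  ultimately show ?thesis using that by blast
qed

text \<open>The additive order of \<open>w\<close> divides both m and k, so it is 1.\<close>

lemma coprime_multiples_zero:
  fixes w :: "'a::ab_group_add"
  assumes "(\<Sum>i<m. w) = 0" "(\<Sum>i<k. w) = 0" "coprime m (k::nat)"
  shows "w = 0"
proof -
  interpret comm_group "additive_group (UNIV :: 'a set)"
    by (rule comm_group_additive_group[OF add_subgroup_UNIV])
  have "ord w dvd m" "ord w dvd k"
    using assms(1,2) pow_eq_id[of w] by (simp_all add: additive_group_pow)
  then have "ord w = 1"
    using assms(3) by (metis coprime_common_divisor_nat)
  then show ?thesis
    using pow_ord_eq_1[of w] by (simp add: additive_group_pow)
qed

section \<open>Centralizers and degrees\<close>

definition centralizer :: "'a::ring \<Rightarrow> 'a set" where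
  "centralizer x = {y. commutator x y = 0}"

lemma commutator_simps [simp]:
  fixes x y z :: "'a::ring"
  shows "commutator x 0 = 0" "commutator x x = 0"
    "commutator x (y + z) = commutator x y + commutator x z"
    "commutator x (y - z) = commutator x y - commutator x z"
    "commutator x (- y) = - commutator x y"
  by (simp_all add: commutator_def algebra_simps)

lemma commutator_sum_left: "commutator (\<Sum>i\<in>A. f i) y = (\<Sum>i\<in>A. commutator (f i) y)"
  by (simp add: commutator_def sum_distrib_left sum_distrib_right sum_subtractf)

lemma commutator_sum_right: "commutator x (\<Sum>i\<in>A. f i) = (\<Sum>i\<in>A. commutator x (f i))"
  by (simp add: commutator_def sum_distrib_left sum_distrib_right sum_subtractf)

lemma add_subgroup_centralizer: "add_subgroup (centralizer x)"
  by (simp add: add_subgroup_def centralizer_def)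

lemma ring_center_iff: "z \<in> ring_center \<longleftrightarrow> (\<forall>y. commutator z y = 0)"
  by (simp add: ring_center_def commutator_def)

lemma add_subgroup_ring_center: "add_subgroup ring_center"
  by (simp add: add_subgroup_def ring_center_def algebra_simps)

lemma ring_center_subset_centralizer: "ring_center \<subseteq> centralizer x"
  by (auto simp: ring_center_def centralizer_def commutator_def)

text \<open>Here m is the index of the center in C(x) and k that of C(x) in R. Since m x is central
  and k y lies in C(x), both m and k annihilate [x, y], which is nonzero for some y.\<close>

lemma noncentral_indices:
  fixes x :: "'a::{ring, finite}"
  assumes "x \<notin> ring_center"
  obtains m k where
    "card (centralizer x) = m * card (ring_center :: 'a set)"
    "CARD('a) = k * card (centralizer x)"
    "2 \<le> m" "2 \<le> k" "\<not> coprime m k"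
proof -
  obtain m where m: "card (centralizer x) = m * card (ring_center :: 'a set)"
    "\<And>y. y \<in> centralizer x \<Longrightarrow> (\<Sum>i<m. y) \<in> ring_center"
    using add_subgroup_index[OF add_subgroup_ring_center add_subgroup_centralizer
        ring_center_subset_centralizer, of x] by auto
  obtain k where k: "CARD('a) = k * card (centralizer x)"
    "\<And>y. (\<Sum>i<k. y) \<in> centralizer x"
    using add_subgroup_index[OF add_subgroup_centralizer add_subgroup_UNIV, of x] by auto
  obtain y where y: "commutator x y \<noteq> 0"
    using assms by (auto simp: ring_center_iff)
  have "x \<in> centralizer x"
    by (simp add: centralizer_def)
  then have "(\<Sum>i<m. commutator x y) = 0"
    using m(2) commutator_sum_left[of "\<lambda>_. x" "{..<m}" y] by (simp add: ring_center_iff)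
  moreover have "(\<Sum>i<k. commutator x y) = 0"
    using k(2)[of y] commutator_sum_right[of x "\<lambda>_. y" "{..<k}"] by (simp add: centralizer_def)
  ultimately have cop: "\<not> coprime m k"
    using y coprime_multiples_zero by blast
  moreover have "card (centralizer x) > 0"
    using \<open>x \<in> centralizer x\<close> by (auto simp: card_gt_0_iff)
  then have "m \<noteq> 0" "k \<noteq> 0"
    using m(1) k(1) zero_less_card_finite[where 'a = 'a] by (metis mult_0 less_irrefl)+
  \<comment> \<open>An index 1 would be coprime to the other index.\<close>
  moreover have "m \<noteq> 1" "k \<noteq> 1"
    using cop by auto
  ultimately show ?thesis
    using that m(1) k(1) by (metis One_nat_def less_2_cases_iff not_less)
qed

text \<open>C(x) is the kernel of the additive map y \<mapsto> [x, y].\<close>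

lemma commutator_fiber:
  fixes x y r :: "'a::ring"
  assumes "commutator x y = r"
  shows "{z. commutator x z = r} = (+) y ` centralizer x"
proof (intro Set.set_eqI iffI)
  fix z assume "z \<in> {z. commutator x z = r}"
  then have "z - y \<in> centralizer x"
    using assms by (simp add: centralizer_def)
  then have "y + (z - y) \<in> (+) y ` centralizer x" by (rule imageI)
  then show "z \<in> (+) y ` centralizer x" by simp
qed (use assms in \<open>auto simp: centralizer_def\<close>)

lemma card_commutator_fiber:
  assumes "commutator x y = r"
  shows "card {z. commutator x z = r} = card (centralizer x)"
  unfolding commutator_fiber[OF assms] by (simp add: card_image)

lemma Delta_degree_zero:
  fixes x :: "'a::{ring, finite}"
  assumes "x \<notin> ring_center"
  shows "Delta_degree 0 x = CARD('a) - card (centralizer x)"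
proof -
  have "{y. Delta_adj 0 x y} = UNIV - centralizer x"
    using assms ring_center_subset_centralizer[of x]
    by (auto simp: Delta_adj_def Delta_verts_def centralizer_def)
  then show ?thesis
    by (simp add: Delta_degree_def card_Diff_subset)
qed

text \<open>R splits into x itself (the final 1), its neighbours, the center, and the fibers over r
  and -r. The number j counts the distinct nonempty fibers: 0 if r is not attained, 1 if it is and r
  = -r, and 2 otherwise.\<close>

lemma Delta_degree_nonzero:
  fixes x r :: "'a::{ring, finite}"
  assumes x: "x \<notin> ring_center" and r: "r \<noteq> 0"
  shows "\<exists>j \<in> {0, 1, 2}. CARD('a) =
    Delta_degree r x + card (ring_center :: 'a set) + j * card (centralizer x) + 1"
proof -
  define A where "A = {y. Delta_adj r x y}"
  define F where "F = {y. commutator x y = r} \<union> {y. commutator x y = - r}"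
  have 0: "commutator x y = 0" if "y \<in> ring_center" for y
    using that ring_center_subset_centralizer[of x] by (auto simp: centralizer_def)
  have "UNIV = insert x ((A \<union> ring_center) \<union> F)"
    using x by (auto simp: A_def F_def Delta_adj_def Delta_verts_def)
  moreover have "x \<notin> (A \<union> ring_center) \<union> F"
    using x r by (auto simp: A_def F_def Delta_adj_def)
  moreover have "(A \<union> ring_center) \<inter> F = {}" "A \<inter> ring_center = {}"
    using r 0 by (auto simp: A_def F_def Delta_adj_def Delta_verts_def)
  ultimately have "CARD('a) = card A + card (ring_center :: 'a set) + card F + 1"
    by (metis (no_types, lifting) Suc_eq_plus1 card_Un_disjoint card_insert_disjoint finite)
  moreover have "\<exists>j \<in> {0, 1, 2}. card F = j * card (centralizer x)"
  proof (cases "\<exists>y. commutator x y = r")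
    case False
    then have "F = {}"
      unfolding F_def using commutator_simps(5)[of x] by (metis (mono_tags) Collect_empty_eq
          minus_minus sup_bot.right_neutral)
    then show ?thesis by simp
  next
    case True
    then obtain y where y: "commutator x y = r" by blast
    then have y': "commutator x (- y) = - r" by simp
    show ?thesis
    proof (cases "r = - r")
      case True
      then have "F = {y. commutator x y = r}" by (auto simp: F_def)
      then show ?thesis using card_commutator_fiber[OF y] by simp
    next
      case False
      then have "card F = card {y. commutator x y = r} + card {y. commutator x y = - r}"
        unfolding F_def by (intro card_Un_disjoint) auto
      then show ?thesis
        using card_commutator_fiber[OF y] card_commutator_fiber[OF y'] by simp
    qed
  qed
  ultimately show ?thesis
    by (auto simp: A_def Delta_degree_def)
qed

section \<open>Arithmetic of the degree equations\<close>

lemma degree_six_zero_order: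
  fixes m k z :: nat
  assumes "k * (m * z) - m * z = 6" "2 \<le> m" "2 \<le> k" "k * (m * z) \<notin> {8, 12}"
  shows "k * (m * z) = 9"
proof -
  obtain k' where k': "k = k' + 1" using assms(3) by (metis add.commute le_Suc_ex one_add_one add.assoc)
  define c where "c = m * z"
  have eq: "k' * c = 6" using assms(1) by (simp add: k' c_def algebra_simps)
  then have "c dvd 6" by (metis dvd_triv_right)
  then have "c \<le> 6" by (simp add: dvd_imp_le)
  moreover have "c \<noteq> 0" using eq by (intro notI) simp
  moreover have "c \<noteq> 1" using assms(2) by (simp add: c_def)
  ultimately consider "c = 2" | "c = 3" | "c = 4" | "c = 5" | "c = 6" by linarith
  \<comment> \<open>The divisors 2, 3, 6 of 6 give the orders 8, 9, 12, of which the hypothesis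
    leaves 9.\<close>
  then show ?thesis
    using eq assms(4) unfolding c_def[symmetric] k' by cases (simp_all, presburger+)
qed

lemma degree_six_nonzero_order:
  fixes m k z j :: nat
  assumes eq: "k * (m * z) = 6 + z + j * (m * z) + 1" and "j \<in> {0, 1, 2}"
    and mk: "2 \<le> m" "2 \<le> k" "\<not> coprime m k"
  shows "k * (m * z) \<in> {8, 12, 16, 24, 28}"
proof -
  \<comment> \<open>Over the integers the terms can be subtracted, which exhibits z as a divisor of
    7.\<close>
  have "int z * (int k * int m - 1 - int j * int m) = 7"
    using arg_cong[OF eq, of int] by (simp add: algebra_simps)
  then have "int z dvd int 7" by (metis dvd_triv_left of_nat_numeral)
  then have "z dvd 7" by (simp only: int_dvd_int_iff)
  then obtain q where q: "z * q = 7" by (metis dvdE)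
  then have "z \<noteq> 0" by (intro notI) simp
  have "z \<le> 7" using \<open>z dvd 7\<close> by (simp add: dvd_imp_le)
  with \<open>z \<noteq> 0\<close> consider "z = 1" | "z = 2" | "z = 3" | "z = 4" | "z = 5" | "z = 6" | "z = 7"
    by linarith
  then have "z = 1 \<or> z = 7"
    using q by cases (simp_all, presburger+)
  \<comment> \<open>Cancelling z leaves n = 7/z + 1.\<close>
  then obtain n where n: "k * m = n + j * m" "z = 1 \<and> n = 8 \<or> z = 7 \<and> n = 2"
    using eq by (elim disjE) (auto simp: algebra_simps)
  have "j < k"
  proof (rule ccontr)
    assume "\<not> j < k"
    then have "k * m \<le> j * m" by simp
    then show False using n by auto
  qed
  then obtain d where d: "k = j + d" by (metis less_imp_add_positive)
  have dm: "d * m = n" using n(1) by (simp add: d algebra_simps)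
  then have "m dvd n" by (metis dvd_triv_right)
  then have "m \<le> n" using n(2) by (auto dest: dvd_imp_le)
  then have "m \<le> 8" using n(2) by auto
  then consider "m = 2" | "m = 3" | "m = 4" | "m = 5" | "m = 6" | "m = 7" | "m = 8"
    using mk(1) by linarith
  then have "(m, d, z) \<in> {(2, 4, 1), (4, 2, 1), (8, 1, 1), (2, 1, 7)}"
    using dm n(2) by cases (auto, presburger+)
  \<comment> \<open>With k = j + d, the only orders k m z outside the list are 10, 42 and 14, from
    (m, k) = (2, 5), (2, 3) and (2, 1); all three pairs are coprime.\<close>
  then show ?thesis
    using assms(2) mk(2,3) unfolding d
    by auto
qed

section \<open>Noncommutative rings of order nine\<close>

lemma card_E_ring: "card (UNIV :: 3 E_ring set) = 9"
proof -
  have "bij (\<lambda>(s, t). E_elem s t :: 3 E_ring)"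
    by (rule bijI') (auto, metis E_ring.exhaust)
  then show ?thesis using bij_betw_same_card by fastforce
qed

lemma card_F_ring: "card (UNIV :: 3 F_ring set) = 9"
proof -
  have "bij (\<lambda>(s, t). F_elem s t :: 3 F_ring)"
    by (rule bijI') (auto, metis F_ring.exhaust)
  then show ?thesis using bij_betw_same_card by fastforce
qed

text \<open>The \<open>itself\<close> parameter lets the locale be interpreted at a given
  type.\<close>

locale ring_order_nine =
  fixes ring_type :: "'a::{ring, finite} itself"
  assumes noncommutative: "\<exists>x y :: 'a. x * y \<noteq> y * x"
    and card_nine: "CARD('a) = 9"
begin

lemma ring_center_trivial: "(ring_center :: 'a set) = {0}"
  and card_centralizer: "x \<notin> ring_center \<Longrightarrow> card (centralizer (x :: 'a)) = 3"
proof -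
  have *: "card (ring_center :: 'a set) = 1 \<and> card (centralizer x) = 3"
    if "x \<notin> ring_center" for x :: 'a
  proof (rule noncentral_indices[OF that])
    fix m k :: nat
    assume mk: "card (centralizer x) = m * card (ring_center :: 'a set)"
      "CARD('a) = k * card (centralizer x)" "2 \<le> m" "2 \<le> k"
    define c where "c = card (centralizer x)"
    have kc: "k * c = 9" using mk(2) by (simp add: card_nine c_def)
    have "c \<noteq> 0" using kc by (intro notI) simp
    \<comment> \<open>The bounds k, m \<ge> 2 exclude c = 9 here and z = 3 below.\<close>
    moreover have "c * 2 \<le> 9" using kc mk(4) by (metis mult.commute mult_le_mono1)
    ultimately consider "c = 1" | "c = 2" | "c = 3" | "c = 4" by linarith
    then have "c = 1 \<or> c = 3" using kc by cases (simp_all, presburger+)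
    moreover have "c \<noteq> 1" using mk(1,3) by (simp add: c_def)
    ultimately have c: "c = 3" by simp
    define z where "z = card (ring_center :: 'a set)"
    have mz: "m * z = 3" using mk(1) c by (simp add: c_def z_def)
    have "z \<noteq> 0" using mz by (intro notI) simp
    moreover have "z * 2 \<le> 3" using mz mk(3) by (metis mult.commute mult_le_mono1)
    ultimately have "z = 1" by linarith
    with c show ?thesis by (simp add: c_def z_def)
  qed
  then show "x \<notin> ring_center \<Longrightarrow> card (centralizer (x :: 'a)) = 3" by blast
  obtain x :: 'a where "x \<notin> ring_center"
    using noncommutative by (auto simp: ring_center_def)
  then have "card (ring_center :: 'a set) = 1" using * by blast
  moreover have "(0 :: 'a) \<in> ring_center" by (simp add: ring_center_def)
  ultimately show "(ring_center :: 'a set) = {0}"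
    by (metis card_1_singletonE singletonD)
qed

text \<open>The index of the zero subgroup in C(x) is 3, so 3 annihilates C(x), which contains
  x.\<close>

lemma char_three: "x + x + x = (0 :: 'a)"
proof (cases "x = 0")
  case False
  then have c: "card (centralizer x) = 3"
    by (simp add: card_centralizer ring_center_trivial)
  obtain n where n: "card (centralizer x) = n * card {0 :: 'a}"
    "\<And>y. y \<in> centralizer x \<Longrightarrow> (\<Sum>i<n. y) \<in> {0}"
    using add_subgroup_index[of "{0 :: 'a}" "centralizer x"] add_subgroup_centralizer[of x]
    by (auto simp: add_subgroup_def)
  have "n = 3" using n(1) c by simp
  moreover have "x \<in> centralizer x" by (simp add: centralizer_def)
  ultimately have "(\<Sum>i<3::nat. x) = 0" using n(2) by blast
  then show ?thesis by (simp add: numeral_3_eq_3 add.assoc)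
qed simp

lemma twice_eq_uminus: "x + x = - (x :: 'a)"
  using char_three[of x] by (simp add: eq_neg_iff_add_eq_0)

lemma uminus_neq: "x \<noteq> 0 \<Longrightarrow> - x \<noteq> (x :: 'a)"
  using twice_eq_uminus[of x] by (metis add_cancel_right_left)

lemma centralizer_eq:
  assumes "x \<noteq> (0 :: 'a)"
  shows "centralizer x = {0, x, - x}"
proof -
  have "card {0, x, - x} = 3" using assms uminus_neq[OF assms] by auto
  moreover have "{0, x, - x} \<subseteq> centralizer x" by (simp add: centralizer_def)
  moreover have "card (centralizer x) = 3"
    using assms by (simp add: card_centralizer ring_center_trivial)
  ultimately show ?thesis by (metis card_subset_eq finite)
qed

lemma commuting_cases:
  assumes "x * y = y * x" "x \<noteq> (0 :: 'a)"
  shows "y = 0 \<or> y = x \<or> y = - x"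
  using centralizer_eq[OF assms(2)] assms(1)
  by (auto simp: centralizer_def commutator_def set_eq_iff)

lemma square_cases: "x * x = 0 \<or> x * x = x \<or> x * x = - (x :: 'a)"
  using commuting_cases[of x "x * x"] by (cases "x = 0") (simp_all add: mult.assoc)

text \<open>If x squares to -x, then -x is idempotent, because x and -x have the same
  square.\<close>

lemma idempotent_up_to_sign:
  assumes "x * x \<noteq> (0 :: 'a)"
  obtains s where "s = x \<or> s = - x" "s * s = s"
  using square_cases[of x] assms that[of x] that[of "- x"] by (metis minus_mult_minus)

lemma ex_nonzero_idempotent:
  obtains a :: 'a where "a * a = a" "a \<noteq> 0"
proof -
  obtain x y :: 'a where xy: "x * y \<noteq> y * x" using noncommutative by blast
  have "\<exists>a :: 'a. a * a \<noteq> 0"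
  proof (rule ccontr)
    assume "\<nexists>a :: 'a. a * a \<noteq> 0"
    then have sq: "a * a = 0" for a :: 'a by blast
    \<comment> \<open>Polarization: expand the square of a + b.\<close>
    have anti: "a * b = - (b * a)" for a b :: 'a
      using sq[of "a + b"] sq[of a] sq[of b] by (simp add: algebra_simps eq_neg_iff_add_eq_0)
    have "x * (x * y) = 0" "y * (x * y) = 0"
      using sq[of x] sq[of y] anti[of x y] by (simp_all flip: mult.assoc) (simp add: mult.assoc)
    moreover from this have "(x * y) * x = 0" "(x * y) * y = 0"
      using anti[of "x * y"] by simp_all
    moreover have "x \<noteq> 0" "y \<noteq> 0" "x * y \<noteq> 0" using xy anti[of y x] by auto
    \<comment> \<open>The nonzero product x y lies in both C(x) and C(y), which forces y = x or y =
      -x.\<close>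
    ultimately have "x * y = x \<or> x * y = - x" "x * y = y \<or> x * y = - y"
      using commuting_cases[of x "x * y"] commuting_cases[of y "x * y"] by metis+
    then have "y = x \<or> y = - x" by (metis minus_minus)
    then show False using xy by auto
  qed
  then show ?thesis
    using that by (metis idempotent_up_to_sign mult_zero_left neg_equal_0_iff_equal)
qed

lemma ex_E_or_F_generators:
  obtains a b :: 'a where "a * a = a" "b * b = b" "a \<noteq> b"
    "a * b = a \<and> b * a = b \<or> a * b = b \<and> b * a = a"
proof -
  obtain a :: 'a where a: "a * a = a" "a \<noteq> 0" by (rule ex_nonzero_idempotent)
  then have "a \<notin> ring_center" by (simp add: ring_center_trivial)
  then obtain x where x: "a * x \<noteq> x * a" by (auto simp: ring_center_def)
  have aa: "a * (a * z) = a * z" for z using a(1) by (metis mult.assoc)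
  \<comment> \<open>The candidates are the Peirce components ax - axa and xa - axa. If both
    vanished, ax = axa = xa would follow.\<close>
  consider n where "n \<noteq> 0" "a * n = n" "n * a = 0" | n where "n \<noteq> 0" "a * n = 0" "n * a = n"
  proof (cases "a * x = a * x * a")
    case False
    then show ?thesis
      using that(1)[of "a * x - a * x * a"] by (simp add: algebra_simps aa a(1))
  next
    case True
    then show ?thesis
      using that(2)[of "x * a - a * x * a"] x by (simp add: algebra_simps aa a(1))
  qed
  then show ?thesis
  proof cases
    case (1 n)
    \<comment> \<open>n n = n (a n) = (n a) n = 0, so a + n is idempotent; this case gives the
      relations of F(9), the next those of E(9).\<close>
    then have "n * n = 0" by (metis mult.assoc mult_zero_left)
    with 1 show ?thesis using that[of a "a + n"] a(1) by (simp add: algebra_simps)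
  next
    case (2 n)
    then have "n * n = 0" by (metis mult.assoc mult_zero_right)
    with 2 show ?thesis using that[of a "a + n"] a(1) by (simp add: algebra_simps)
  qed
qed

section \<open>Coordinates over the field of three elements\<close>

definition scale :: "3 \<Rightarrow> 'a \<Rightarrow> 'a" where
  "scale s v = (if s = 0 then 0 else if s = 1 then v else - v)"

lemma cases_3: "(s :: 3) = 0 \<or> s = 1 \<or> s = 2"
proof -
  have "card {0, 1, 2 :: 3} = CARD(3)" by simp
  then have "{0, 1, 2 :: 3} = UNIV" by (metis card_subset_eq finite subset_UNIV)
  then show ?thesis by blast
qed

text \<open>The scalars 3 and 4 cover 1 + 2, 2 + 2 and 2 * 2 before reduction modulo 3.\<close>

lemma scale_simps [simp]:
  "scale 0 v = 0" "scale 1 v = v" "scale 2 v = - v" "scale 3 v = 0" "scale 4 v = v"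
  by (simp_all add: scale_def)

text \<open>Characteristic three makes the action additive: 1 + 1 = 2 acts as -1 because v + v =
  -v.\<close>

lemma scale_add: "scale (s + t) v = scale s v + scale t v"
  using cases_3[of s] cases_3[of t] twice_eq_uminus[of v] twice_eq_uminus[of "- v"] by auto

lemma scale_diff: "scale (s - t) v = scale s v - scale t v"
  using scale_add[of "s - t" t v] by (simp add: algebra_simps)

lemma scale_mult: "scale s v * scale t w = scale (s * t) (v * w)"
  using cases_3[of s] cases_3[of t] by auto

text \<open>A nontrivial relation would make a or b zero, or give a = b or a = -b; in each case a
  and b commute.\<close>

lemma scale_independent:
  assumes "a * b \<noteq> b * a" "scale s a = scale t b"
  shows "s = 0 \<and> t = 0"
proof -
  have "a \<noteq> 0" "b \<noteq> 0" "a \<noteq> b" "a \<noteq> - b" using assms(1) by auto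
  then show ?thesis
    using cases_3[of s] cases_3[of t] assms(2) by (auto simp: minus_equation_iff[of a])
qed

lemma scale_combination_eq_iff:
  assumes "a * b \<noteq> b * a"
  shows "scale s a + scale t b = scale u a + scale v b \<longleftrightarrow> s = u \<and> t = v"
proof
  assume "scale s a + scale t b = scale u a + scale v b"
  then have "scale (s - u) a = scale (v - t) b" by (simp add: scale_diff algebra_simps)
  then show "s = u \<and> t = v" using scale_independent[OF assms] by fastforce
qed simp

text \<open>An injection between sets of nine elements is bijective. Maps out of E(9) and F(9) are
  easy to define from coordinates; this inverts them.\<close>

lemma ring_iso_inverse:
  fixes g :: "'b::ring \<Rightarrow> 'a"
  assumes "inj g" "card (UNIV :: 'b set) = 9"
    and add: "\<And>p q. g (p + q) = g p + g q" and mult: "\<And>p q. g (p * q) = g p * g q"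
  shows "\<exists>f :: 'a \<Rightarrow> 'b. is_ring_iso f"
proof -
  have "card (range g) = CARD('a)"
    using assms(1,2) by (simp add: card_image card_nine)
  then have "surj g" by (metis card_subset_eq finite subset_UNIV)
  with \<open>inj g\<close> have "bij g" by (simp add: bij_def)
  define h where "h = inv_into UNIV g"
  have h: "g (h x) = x" "h (g p) = p" for x p
    using \<open>bij g\<close> by (simp_all add: h_def bij_def surj_f_inv_f)
  have "h (x + y) = h x + h y" "h (x * y) = h x * h y" for x y
    using h add mult by metis+
  then show ?thesis
    using \<open>bij g\<close> unfolding is_ring_iso_def h_def by (metis bij_imp_bij_inv)
qed

lemma iso_E_or_F:
  "(\<exists>f :: 'a \<Rightarrow> 3 E_ring. is_ring_iso f) \<or> (\<exists>f :: 'a \<Rightarrow> 3 F_ring. is_ring_iso f)"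
proof -
  obtain a b :: 'a where idem: "a * a = a" "b * b = b" and "a \<noteq> b"
    and ab: "a * b = a \<and> b * a = b \<or> a * b = b \<and> b * a = a"
    by (rule ex_E_or_F_generators)
  then have nc: "a * b \<noteq> b * a" by metis
  from ab show ?thesis
  proof
    assume ab: "a * b = a \<and> b * a = b"
    define g where "g p = (case p of E_elem s t \<Rightarrow> scale s a + scale t b)" for p
    have "inj g"
      using scale_combination_eq_iff[OF nc]
      by (auto simp: g_def inj_def split: E_ring.splits)
    moreover have "g (p + q) = g p + g q" "g (p * q) = g p * g q" for p q
      by (cases p; cases q; simp add: g_def scale_add scale_mult idem ab algebra_simps)+
    ultimately show ?thesis using ring_iso_inverse card_E_ring by blast
  next
    assume ab: "a * b = b \<and> b * a = a"
    define g where "g p = (case p of F_elem s t \<Rightarrow> scale s a + scale t b)" for p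
    have "inj g"
      using scale_combination_eq_iff[OF nc]
      by (auto simp: g_def inj_def split: F_ring.splits)
    moreover have "g (p + q) = g p + g q" "g (p * q) = g p * g q" for p q
      by (cases p; cases q; simp add: g_def scale_add scale_mult idem ab algebra_simps)+
    ultimately show ?thesis using ring_iso_inverse card_F_ring by blast
  qed
qed

end

text \<open>Serves the converse: in a noncommutative ring of order 9 every vertex has a centralizer
  of order 3, hence degree 9 - 3 = 6 for r = 0.\<close>

lemma card_nine_if_iso:
  assumes "(\<exists>f :: 'a::{ring, finite} \<Rightarrow> 3 E_ring. is_ring_iso f) \<or>
    (\<exists>f :: 'a \<Rightarrow> 3 F_ring. is_ring_iso f)"
  shows "CARD('a) = 9"
  using assms by (metis is_ring_iso_def bij_betw_same_card card_E_ring card_F_ring)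

theorem theorem4p18:
  fixes r :: "'a::{ring, finite}"
  assumes noncomm: "\<exists>x y :: 'a. x * y \<noteq> y * x"
    and order: "CARD('a) \<notin> {8, 12, 16, 24, 28}"
  shows "(\<exists>x \<in> Delta_verts. Delta_degree r x = 6) \<longleftrightarrow>
    r = 0 \<and> ((\<exists>f :: 'a \<Rightarrow> 3 E_ring. is_ring_iso f) \<or> (\<exists>f :: 'a \<Rightarrow> 3 F_ring. is_ring_iso f))"
proof
  assume "\<exists>x \<in> Delta_verts. Delta_degree r x = 6"
  then obtain x where x: "x \<notin> ring_center" and deg: "Delta_degree r x = 6"
    by (auto simp: Delta_verts_def)
  obtain m k where mk: "card (centralizer x) = m * card (ring_center :: 'a set)"
    "CARD('a) = k * card (centralizer x)" "2 \<le> m" "2 \<le> k" "\<not> coprime m k"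
    by (rule noncentral_indices[OF x])
  have r: "r = 0"
  proof (rule ccontr)
    assume "r \<noteq> 0"
    then have "CARD('a) \<in> {8, 12, 16, 24, 28}"
      using Delta_degree_nonzero[OF x] degree_six_nonzero_order[OF _ _ mk(3-5)] deg mk(1,2)
      by metis
    with order show False by contradiction
  qed
  have "k * (m * card (ring_center :: 'a set)) = 9"
    using Delta_degree_zero[OF x] deg r mk order by (intro degree_six_zero_order) auto
  then have "CARD('a) = 9" using mk(1,2) by simp
  then interpret ring_order_nine "TYPE('a)"
    using noncomm by unfold_locales auto
  show "r = 0 \<and> ((\<exists>f :: 'a \<Rightarrow> 3 E_ring. is_ring_iso f) \<or> (\<exists>f :: 'a \<Rightarrow> 3 F_ring. is_ring_iso f))"
    using r iso_E_or_F by simp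
next
  assume *: "r = 0 \<and> ((\<exists>f :: 'a \<Rightarrow> 3 E_ring. is_ring_iso f) \<or> (\<exists>f :: 'a \<Rightarrow> 3 F_ring. is_ring_iso f))"
  then interpret ring_order_nine "TYPE('a)"
    using noncomm card_nine_if_iso by unfold_locales auto
  obtain x :: 'a where x: "x \<notin> ring_center"
    using noncomm by (auto simp: ring_center_def)
  then have "Delta_degree r x = 6"
    using * Delta_degree_zero[OF x] card_centralizer card_nine by simp
  with x show "\<exists>x \<in> Delta_verts. Delta_degree r x = 6"
    by (auto simp: Delta_verts_def)
qed

end
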